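(* Consider the Markov transition matrices $$T_1=\begin{pmatrix}1&1&1\\1&0&1\\0&1&0\end{pmatrix}\ (\text{alphabet }\{a,b,c\}),\qquad T_2=\begin{pmatrix}1&1&1\\1&1&0\\0&1&0\end{pmatrix}\ (\text{alphabet }\{x,y,z\}),$$ with rows and columns indexed by the letters in the listed order. Then the inverse hulls $H(S_{T_1})$ and $H(S_{T_2})$ are isomorphic inverse semigroups, but the Markov shifts associated with $T_1$ and $T_2$ have distinct entropies and are not conjugate.
   Context: For a finite alphabet $A$ and a $\{0,1\}$-matrix $T=(T_{a,b})_{a,b\in A}$ with no zero row, the Markov subshift of $T$ is the set of infinite words $a_1a_2a_3\cdots$ over $A$ with $T_{a_i,a_{i+1}}=1$ for all $i$; $L_T$ is the set of all finite nonempty words occurring as subwords of elements of the subshift. $S_T=L_T\cup\{0\}$ is a semigroup with zero under $x*y=xy$ (concatenation) if $xy\in L_T$ and $x*y=0$ otherwise. For $s\in L_T$, $\theta_s$ is the partial bijection of $L_T$ with domain $\{x\in L_T: sx\in L_T\}$, given by $\theta_s(x)=sx$. The inverse hull $H(S_T)$ is the inverse semigroup with $0$ generated by $\{\theta_s:s\in L_T\}$ inside the symmetric inverse monoid of partial bijections of $L_T$ (composition on the largest possible domain); $0$ is the empty map. Entropy of a shift is $\lim_{n\to\infty}\frac1n\log(\text{number of words of length }n\text{ in its language})$. Two shifts are conjugate if there is a shift-commuting homeomorphism between them. *)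

theory Defs
  imports "HOL-Analysis.Analysis"
begin

section \<open>Markov shifts\<close>

type_synonym 'a transition_matrix = "'a \<Rightarrow> 'a \<Rightarrow> nat"

definition markov_matrix :: "'a transition_matrix \<Rightarrow> bool" where
  "markov_matrix T \<longleftrightarrow> (\<forall>s t. T s t \<in> {0, 1}) \<and> (\<forall>s. \<exists>t. T s t \<noteq> 0)"

definition markov_shift :: "'a transition_matrix \<Rightarrow> (nat \<Rightarrow> 'a) set" where
  "markov_shift T = {x. \<forall>i. T (x i) (x (Suc i)) = 1}"

definition language :: "(nat \<Rightarrow> 'a) set \<Rightarrow> 'a list set" where
  "language X = {w. w \<noteq> [] \<and> (\<exists>x\<in>X. \<exists>i. w = map x [i..<i + length w])}"

definition has_entropy :: "(nat \<Rightarrow> 'a) set \<Rightarrow> real \<Rightarrow> bool" where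
  "has_entropy X h \<longleftrightarrow>
     (\<lambda>n. ln (real (card {w \<in> language X. length w = n})) / real n) \<longlonglongrightarrow> h"

definition shift_map :: "(nat \<Rightarrow> 'a) \<Rightarrow> (nat \<Rightarrow> 'a)" where
  "shift_map x = (\<lambda>i. x (Suc i))"

definition shift_topology :: "(nat \<Rightarrow> 'a) set \<Rightarrow> (nat \<Rightarrow> 'a) topology" where
  "shift_topology X =
     subtopology (product_topology (\<lambda>_. discrete_topology UNIV) UNIV) X"

lemma topspace_shift_topology [simp]: "topspace (shift_topology X) = X"
  by (simp add: shift_topology_def)

definition conjugate_shifts :: "(nat \<Rightarrow> 'a) set \<Rightarrow> (nat \<Rightarrow> 'b) set \<Rightarrow> bool" where
  "conjugate_shifts X Y \<longleftrightarrow>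
     (\<exists>h. homeomorphic_map (shift_topology X) (shift_topology Y) h \<and>
          (\<forall>x\<in>X. h (shift_map x) = shift_map (h x)))"

section \<open>Inverse hulls\<close>

text \<open>Partial bijections are represented by partial functions that are injective on their
  domain; \<open>f \<circ>\<^sub>m g\<close> is composition (first \<open>g\<close>, then \<open>f\<close>) on the largest possible domain.\<close>

definition sym_inv_monoid :: "'a set \<Rightarrow> ('a \<rightharpoonup> 'a) set" where
  "sym_inv_monoid X = {f. dom f \<subseteq> X \<and> ran f \<subseteq> X \<and> inj_on f (dom f)}"

definition pinv :: "('a \<rightharpoonup> 'a) \<Rightarrow> ('a \<rightharpoonup> 'a)" where
  "pinv f = (\<lambda>y. if y \<in> ran f then Some (THE x. f x = Some y) else None)"

lemma pinv_eq_Some_iff: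
  assumes "inj_on f (dom f)"
  shows "pinv f y = Some x \<longleftrightarrow> f x = Some y"
proof -
  have uniq: "x = x'" if "f x = Some y" "f x' = Some y" for x x'
    using assms that by (metis domI inj_onD)
  have "(THE x. f x = Some y) = x" if "f x = Some y" for x
    using that uniq by (intro the_equality) auto
  then show ?thesis
    by (auto simp: pinv_def ran_def)
qed

definition left_translation :: "'a list set \<Rightarrow> 'a list \<Rightarrow> ('a list \<rightharpoonup> 'a list)" where
  "left_translation L s = (\<lambda>x. if x \<in> L \<and> s @ x \<in> L then Some (s @ x) else None)"

text \<open>\<open>inverse_hull L\<close> is the inverse semigroup \<open>H(S)\<close> of \<open>S = L \<union> {0}\<close>, whose product is
  concatenation when the result lies in \<open>L\<close> and \<open>0\<close> otherwise. The zero is the empty map.\<close>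

inductive_set inverse_hull :: "'a list set \<Rightarrow> ('a list \<rightharpoonup> 'a list) set" for L where
  zero: "Map.empty \<in> inverse_hull L"
| generator: "s \<in> L \<Longrightarrow> left_translation L s \<in> inverse_hull L"
| comp: "f \<in> inverse_hull L \<Longrightarrow> g \<in> inverse_hull L \<Longrightarrow> f \<circ>\<^sub>m g \<in> inverse_hull L"
| inverse: "f \<in> inverse_hull L \<Longrightarrow> pinv f \<in> inverse_hull L"

lemma pinv_in_sym_inv_monoid:
  assumes "f \<in> sym_inv_monoid X"
  shows "pinv f \<in> sym_inv_monoid X"
proof -
  have inj: "inj_on f (dom f)" and X: "dom f \<subseteq> X" "ran f \<subseteq> X"
    using assms by (auto simp: sym_inv_monoid_def)
  note eq = pinv_eq_Some_iff[OF inj]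
  have "dom (pinv f) \<subseteq> ran f"
    by (auto simp: pinv_def split: if_splits)
  moreover have "ran (pinv f) \<subseteq> dom f"
    using eq by (simp add: ran_def dom_def subset_iff)
  ultimately have "dom (pinv f) \<subseteq> X" "ran (pinv f) \<subseteq> X"
    using X by simp_all
  moreover have "inj_on (pinv f) (dom (pinv f))"
  proof (rule inj_onI)
    fix y z assume "y \<in> dom (pinv f)" "pinv f y = pinv f z"
    then obtain x where "pinv f y = Some x" "pinv f z = Some x" by (metis domD)
    then show "y = z" using eq by (metis option.inject)
  qed
  ultimately show ?thesis by (simp add: sym_inv_monoid_def)
qed

lemma comp_in_sym_inv_monoid:
  assumes "f \<in> sym_inv_monoid X" "g \<in> sym_inv_monoid X"
  shows "f \<circ>\<^sub>m g \<in> sym_inv_monoid X"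
proof -
  have inj: "inj_on f (dom f)" "inj_on g (dom g)"
    using assms by (auto simp: sym_inv_monoid_def)
  have "dom (f \<circ>\<^sub>m g) \<subseteq> dom g" "ran (f \<circ>\<^sub>m g) \<subseteq> ran f"
    by (fastforce simp: dom_def map_comp_Some_iff) (fastforce simp: ran_def map_comp_Some_iff)
  then have "dom (f \<circ>\<^sub>m g) \<subseteq> X" "ran (f \<circ>\<^sub>m g) \<subseteq> X"
    using assms unfolding sym_inv_monoid_def by blast+
  moreover have "inj_on (f \<circ>\<^sub>m g) (dom (f \<circ>\<^sub>m g))"
  proof (rule inj_onI)
    fix x x' assume "x \<in> dom (f \<circ>\<^sub>m g)" and eq: "(f \<circ>\<^sub>m g) x = (f \<circ>\<^sub>m g) x'"
    then obtain z where z: "(f \<circ>\<^sub>m g) x = Some z" by blast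
    from z obtain y where y: "g x = Some y" "f y = Some z"
      by (auto simp: map_comp_Some_iff)
    from z eq obtain y' where y': "g x' = Some y'" "f y' = Some z"
      by (auto simp: map_comp_Some_iff)
    have "y = y'" using inj(1) y(2) y'(2) by (metis domI inj_onD)
    with inj(2) y(1) y'(1) show "x = x'" by (metis domI inj_onD)
  qed
  ultimately show ?thesis
    by (simp add: sym_inv_monoid_def)
qed

lemma inverse_hull_subset: "inverse_hull L \<subseteq> sym_inv_monoid L"
proof
  fix f assume "f \<in> inverse_hull L"
  then show "f \<in> sym_inv_monoid L"
  proof induction
    case (generator s)
    then show ?case
      by (auto simp: sym_inv_monoid_def left_translation_def dom_def ran_def inj_on_def
               split: if_splits)
  next
    case zero
    show ?case by (simp add: sym_inv_monoid_def)
  qed (simp_all add: comp_in_sym_inv_monoid pinv_in_sym_inv_monoid)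
qed

lemma inverse_hull_regular:
  assumes "f \<in> inverse_hull L"
  shows "f \<circ>\<^sub>m (pinv f \<circ>\<^sub>m f) = f"
proof
  fix x
  have "inj_on f (dom f)"
    using assms inverse_hull_subset by (auto simp: sym_inv_monoid_def)
  then have "pinv f y = Some x" if "f x = Some y" for y
    using that by (simp add: pinv_eq_Some_iff)
  then show "(f \<circ>\<^sub>m (pinv f \<circ>\<^sub>m f)) x = f x"
    by (cases "f x") (simp_all add: map_comp_def)
qed

definition inverse_semigroup_isomorphic ::
  "('a \<rightharpoonup> 'a) set \<Rightarrow> ('b \<rightharpoonup> 'b) set \<Rightarrow> bool" where
  "inverse_semigroup_isomorphic H K \<longleftrightarrow>
     (\<exists>\<phi>. bij_betw \<phi> H K \<and>
          (\<forall>f\<in>H. \<forall>g\<in>H. \<phi> (f \<circ>\<^sub>m g) = \<phi> f \<circ>\<^sub>m \<phi> g) \<and>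
          (\<forall>f\<in>H. \<phi> (pinv f) = pinv (\<phi> f)))"

section \<open>The two transition matrices\<close>

datatype abc = La | Lb | Lc
datatype xyz = Lx | Ly | Lz

text \<open>One equation per row; the arguments of \<open>case_abc\<close> and \<open>case_xyz\<close> are the entries of that
  row in the order of the alphabet.\<close>

primrec T1 :: "abc transition_matrix" where
  "T1 La = case_abc 1 1 1"
| "T1 Lb = case_abc 1 0 1"
| "T1 Lc = case_abc 0 1 0"

primrec T2 :: "xyz transition_matrix" where
  "T2 Lx = case_xyz 1 1 1"
| "T2 Ly = case_xyz 1 1 0"
| "T2 Lz = case_xyz 0 1 0"

lemma markov_matrix_T1: "markov_matrix T1"
proof -
  have "T1 s t \<in> {0, 1}" for s t by (cases s; cases t) simp_all
  moreover have "\<exists>t. T1 s t \<noteq> 0" for s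
    by (cases s) (auto intro: exI[of _ La] exI[of _ Lb])
  ultimately show ?thesis unfolding markov_matrix_def by blast
qed

lemma markov_matrix_T2: "markov_matrix T2"
proof -
  have "T2 s t \<in> {0, 1}" for s t by (cases s; cases t) simp_all
  moreover have "\<exists>t. T2 s t \<noteq> 0" for s
    by (cases s) (auto intro: exI[of _ Lx] exI[of _ Ly])
  ultimately show ?thesis unfolding markov_matrix_def by blast
qed

end

theory Submission
  imports Defs "HOL-Library.Sublist"
begin

text \<open>For each of the two matrices, a nonzero element of the inverse hull is a map
  \<open>t x \<mapsto> s x\<close>, where \<open>x\<close> ranges over the words starting in some set \<open>A\<close> from the intersection
  closure of the follower sets. These sets are \<open>{a, b, c}, {a, c}, {b}\<close> for \<open>T1\<close> and
  \<open>{x, y, z}, {x, y}, {y}\<close> for \<open>T2\<close>. In both cases the domains \<open>t A\<close>, ordered by inclusion, are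
  the paths from \<open>P\<close> in the graph with edges \<open>P \<rightarrow> Q\<close>, \<open>P \<rightarrow> R\<close>, \<open>Q \<rightarrow> P\<close>, \<open>Q \<rightarrow> R\<close>, \<open>R \<rightarrow> Q\<close>, where
  \<open>P, Q, R\<close> are the three sets in the order listed. Hence both hulls are the semigroup of pairs of
  paths from \<open>P\<close> with a common end, with zero, inside the graph inverse semigroup. The entropies
  are logarithms of Perron eigenvalues, computed from positive eigenvectors.\<close>

section \<open>Languages and entropy of Markov shifts\<close>

text \<open>Since no row of \<open>T\<close> is zero, every finite path of letters continues to an
  infinite one, so finite admissibility alone characterises the language.\<close>

lemma language_markov_shift:
  assumes "markov_matrix T"
  shows "language (markov_shift T) = {w. w \<noteq> [] \<and> successively (\<lambda>s t. T s t = 1) w}"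
proof (intro equalityI subsetI)
  fix w assume "w \<in> language (markov_shift T)"
  then obtain x i where ne: "w \<noteq> []" and x: "\<And>j. T (x j) (x (Suc j)) = 1"
    and w: "w = map x [i..<i + length w]"
    by (auto simp: language_def markov_shift_def)
  have "w ! j = x (i + j)" if "j < length w" for j
    using that by (subst w) simp
  with ne x show "w \<in> {w. w \<noteq> [] \<and> successively (\<lambda>s t. T s t = 1) w}"
    by (auto simp: successively_conv_nth)
next
  fix w assume "w \<in> {w. w \<noteq> [] \<and> successively (\<lambda>s t. T s t = 1) w}"
  then have ne: "w \<noteq> []" and path: "\<And>j. Suc j < length w \<Longrightarrow> T (w ! j) (w ! Suc j) = 1"
    by (auto simp: successively_conv_nth)
  have "\<forall>s. \<exists>t. T s t = 1"
    using assms unfolding markov_matrix_def by (metis insertE singletonD)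
  then obtain next_letter where nl: "\<And>s. T s (next_letter s) = 1" by metis
  \<comment> \<open>The word is continued by iterating \<open>next_letter\<close> from its last
    letter; the exponent is 1 at the first index past the word.\<close>
  define x where
    "x i = (if i < length w then w ! i else (next_letter ^^ (Suc i - length w)) (last w))" for i
  have "T (x i) (x (Suc i)) = 1" for i
  proof -
    consider "Suc i < length w" | "Suc i = length w" | "length w \<le> i" by linarith
    then show ?thesis
    proof cases
      case 2
      then have "x i = last w" "x (Suc i) = next_letter (last w)"
        using ne by (auto simp: x_def last_conv_nth) (metis diff_Suc_1')
      then show ?thesis by (simp add: nl)
    next
      case 3
      then have "x (Suc i) = next_letter (x i)" by (simp add: x_def Suc_diff_le)
      then show ?thesis by (simp add: nl)
    qed (simp add: x_def path)
  qed
  moreover have "w = map x [0..<0 + length w]"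
    by (auto intro: nth_equalityI simp: x_def)
  ultimately show "w \<in> language (markov_shift T)"
    using ne unfolding language_def markov_shift_def by blast
qed

lemma language_append_right:
  assumes "markov_matrix T" "u @ v \<in> language (markov_shift T)" "v \<noteq> []"
  shows "v \<in> language (markov_shift T)"
  using assms by (auto simp: language_markov_shift successively_append_iff)

section \<open>Entropy from a positive eigenvector\<close>

lemma words_from_letter_Suc:
  "{w. length w = Suc (Suc n) \<and> hd w = s \<and> successively P w} =
   (\<Union>t\<in>{t. P s t}. (#) s ` {w. length w = Suc n \<and> hd w = t \<and> successively P w})"
proof (intro equalityI subsetI)
  fix w assume "w \<in> {w. length w = Suc (Suc n) \<and> hd w = s \<and> successively P w}"
  then obtain v where "w = s # v" "length v = Suc n" "successively P (s # v)"
    by (cases w) auto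
  then show "w \<in> (\<Union>t\<in>{t. P s t}.
      (#) s ` {w. length w = Suc n \<and> hd w = t \<and> successively P w})"
    by (auto simp: successively_Cons)
qed (auto simp: successively_Cons)

text \<open>The word counts by first letter and the vectors \<open>v s * \<mu> ^ n\<close> obey the
  same recursion under \<open>T\<close>. As \<open>T\<close> has nonnegative entries, comparisons
  between them persist from n = 0. The counts thus lie between constant multiples of powers of
  \<open>\<mu>\<close>, and the constants vanish after taking logarithms and dividing by n.\<close>

lemma has_entropy_eigenvector:
  fixes T :: "'a transition_matrix" and v :: "'a \<Rightarrow> real"
  assumes T: "markov_matrix T" and fin: "finite (UNIV :: 'a set)"
    and v: "\<And>s. v s > 0" and \<mu>: "\<mu> > 0"
    and eigen: "\<And>s. (\<Sum>t\<in>UNIV. real (T s t) * v t) = \<mu> * v s"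
  shows "has_entropy (markov_shift T) (ln \<mu>)"
proof -
  \<comment> \<open>The length is \<open>Suc n\<close>, so that \<open>W 0 s\<close> consists of the
    single word \<open>[s]\<close>.\<close>
  define W where
    "W n s = {w. length w = Suc n \<and> hd w = s \<and> successively (\<lambda>s t. T s t = 1) w}" for n s
  define m where "m = Min (range v)"
  define M where "M = Max (range v)"
  have m: "m > 0" "\<And>s. m \<le> v s" and M: "\<And>s. v s \<le> M"
    using fin v by (auto simp: m_def M_def)
  have "M > 0" using v M less_le_trans by blast
  have finW: "finite (W n s)" for n s
  proof -
    have "W n s \<subseteq> {w. set w \<subseteq> UNIV \<and> length w = Suc n}" by (auto simp: W_def)
    then show ?thesis using finite_lists_length_eq[OF fin] finite_subset by blast
  qed
  have T01: "real (T s t) = (if T s t = 1 then 1 else 0)" for s t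
  proof -
    have "T s t \<in> {0, 1}" using T unfolding markov_matrix_def by blast
    then show ?thesis by auto
  qed
  have W0: "card (W 0 s) = 1" for s
  proof -
    have "W 0 s = {[s]}" by (auto simp: W_def length_Suc_conv)
    then show ?thesis by simp
  qed
  have WSuc: "real (card (W (Suc n) s)) = (\<Sum>t\<in>UNIV. real (T s t) * real (card (W n t)))" for n s
  proof -
    have "W (Suc n) s = (\<Union>t\<in>{t. T s t = 1}. (#) s ` W n t)"
      unfolding W_def by (rule words_from_letter_Suc)
    moreover have "card (\<Union>t\<in>{t. T s t = 1}. (#) s ` W n t) = (\<Sum>t | T s t = 1. card ((#) s ` W n t))"
      by (rule card_UN_disjoint) (use finW finite_subset[OF subset_UNIV fin] in \<open>auto simp: W_def\<close>)
    moreover have "card ((#) s ` W n t) = card (W n t)" for t by (simp add: card_image)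
    ultimately have "real (card (W (Suc n) s)) = (\<Sum>t | T s t = 1. real (card (W n t)))" by simp
    also have "\<dots> = (\<Sum>t\<in>UNIV. real (T s t) * real (card (W n t)))"
      by (rule sum.mono_neutral_cong_left) (use fin T01 in auto)
    finally show ?thesis .
  qed
  have bounds: "m * real (card (W n s)) \<le> v s * \<mu> ^ n \<and> v s * \<mu> ^ n \<le> M * real (card (W n s))"
    for n s
  proof (induction n arbitrary: s)
    case 0
    show ?case using m(2) M by (simp add: W0)
  next
    case (Suc n)
    have "v s * \<mu> ^ Suc n = (\<Sum>t\<in>UNIV. real (T s t) * v t) * \<mu> ^ n" by (simp add: eigen)
    also have "\<dots> = (\<Sum>t\<in>UNIV. real (T s t) * (v t * \<mu> ^ n))"
      by (simp add: sum_distrib_right mult.assoc)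
    finally have eq: "v s * \<mu> ^ Suc n = (\<Sum>t\<in>UNIV. real (T s t) * (v t * \<mu> ^ n))" .
    have scale: "c * real (card (W (Suc n) s)) = (\<Sum>t\<in>UNIV. real (T s t) * (c * real (card (W n t))))" for c
      by (simp add: WSuc sum_distrib_left mult.left_commute)
    show ?case unfolding eq scale using Suc by (intro conjI sum_mono mult_left_mono) auto
  qed
  define C where "C n = real (card {w \<in> language (markov_shift T). length w = n})" for n
  have C: "C (Suc n) = (\<Sum>s\<in>UNIV. real (card (W n s)))" for n
  proof -
    have "{w \<in> language (markov_shift T). length w = Suc n} = (\<Union>s. W n s)"
      by (auto simp: language_markov_shift[OF T] W_def)
    moreover have "card (\<Union>s. W n s) = (\<Sum>s\<in>UNIV. card (W n s))"
      by (rule card_UN_disjoint) (use fin finW in \<open>auto simp: W_def\<close>)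
    ultimately show ?thesis by (simp add: C_def)
  qed
  define V where "V = (\<Sum>s\<in>UNIV. v s)"
  have "V > 0" unfolding V_def using fin v by (intro sum_pos) auto
  have CM: "m * C (Suc n) \<le> V * \<mu> ^ n" "V * \<mu> ^ n \<le> M * C (Suc n)" for n
    unfolding C V_def sum_distrib_left sum_distrib_right using bounds by (auto intro!: sum_mono)
  \<comment> \<open>Words of length n are counted by \<open>W (n - 1)\<close>, hence the exponent n
    - 1.\<close>
  have "ln (V / M) + (real n - 1) * ln \<mu> \<le> ln (C n) \<and> ln (C n) \<le> ln (V / m) + (real n - 1) * ln \<mu>"
    if n: "n \<ge> 1" for n
  proof -
    obtain k where k: "n = Suc k" using n by (cases n) auto
    have "V / M * \<mu> ^ k \<le> C n" "C n \<le> V / m * \<mu> ^ k"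
      using CM[of k] \<open>M > 0\<close> m(1) by (auto simp: k field_simps)
    moreover have pos: "V / M * \<mu> ^ k > 0" "V / m * \<mu> ^ k > 0"
      using \<open>V > 0\<close> \<open>M > 0\<close> m(1) \<mu> by auto
    ultimately have "ln (V / M * \<mu> ^ k) \<le> ln (C n)" "ln (C n) \<le> ln (V / m * \<mu> ^ k)"
      by (auto intro!: ln_mono)
    moreover have "ln (c * \<mu> ^ k) = ln c + (real n - 1) * ln \<mu>" if "c > 0" for c
      using that \<mu> by (simp add: k ln_mult ln_realpow)
    ultimately show ?thesis using \<open>V > 0\<close> \<open>M > 0\<close> m(1) by (metis divide_pos_pos)
  qed
  then have sandwich: "\<forall>\<^sub>F n in sequentially. (ln (V / M) + (real n - 1) * ln \<mu>) / real n \<le> ln (C n) / real n"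
    "\<forall>\<^sub>F n in sequentially. ln (C n) / real n \<le> (ln (V / m) + (real n - 1) * ln \<mu>) / real n"
    by (auto intro!: eventually_sequentiallyI[of 1] divide_right_mono)
  have limit: "(\<lambda>n. (c + (real n - 1) * l) / real n) \<longlonglongrightarrow> l" for c l :: real
  proof (rule Lim_transform_eventually)
    show "(\<lambda>n. (c - l) / real n + l) \<longlonglongrightarrow> l"
      using tendsto_add[OF lim_const_over_n[of "c - l"] tendsto_const[of l]] by simp
    show "\<forall>\<^sub>F n in sequentially. (c - l) / real n + l = (c + (real n - 1) * l) / real n"
      by (rule eventually_sequentiallyI[of 1]) (simp add: field_simps)
  qed
  show ?thesis
    unfolding has_entropy_def C_def[symmetric]
    by (rule tendsto_sandwich[OF sandwich limit limit])
qed

section \<open>Path pairs in a graph\<close>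

primrec path_end :: "'v \<Rightarrow> 'v list \<Rightarrow> 'v" where
  "path_end u [] = u"
| "path_end u (v # p) = path_end v p"

primrec is_path :: "('v \<Rightarrow> 'v \<Rightarrow> bool) \<Rightarrow> 'v \<Rightarrow> 'v list \<Rightarrow> bool" where
  "is_path E u [] \<longleftrightarrow> True"
| "is_path E u (v # p) \<longleftrightarrow> E u v \<and> is_path E v p"

primrec path_word :: "('v \<Rightarrow> 'v \<Rightarrow> 'a list) \<Rightarrow> 'v \<Rightarrow> 'v list \<Rightarrow> 'a list" where
  "path_word lab u [] = []"
| "path_word lab u (v # p) = lab u v @ path_word lab v p"

lemma path_end_append [simp]: "path_end u (p @ q) = path_end (path_end u p) q"
  by (induction p arbitrary: u) auto

lemma is_path_append [simp]: "is_path E u (p @ q) \<longleftrightarrow> is_path E u p \<and> is_path E (path_end u p) q"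
  by (induction p arbitrary: u) auto

lemma path_word_append [simp]:
  "path_word lab u (p @ q) = path_word lab u p @ path_word lab (path_end u p) q"
  by (induction p arbitrary: u) auto

text \<open>\<open>Some (p, q)\<close> stands for \<open>p q\<^sup>-\<^sup>1\<close> in the graph inverse semigroup, \<open>None\<close> for its zero.\<close>

definition path_pairs :: "('v \<Rightarrow> 'v \<Rightarrow> bool) \<Rightarrow> 'v \<Rightarrow> ('v list \<times> 'v list) option set" where
  "path_pairs E r =
     insert None {Some (p, q) | p q. is_path E r p \<and> is_path E r q \<and> path_end r p = path_end r q}"

text \<open>The middle factor \<open>q\<^sup>-\<^sup>1 p'\<close> cancels along the common prefix
  and survives only if one path extends the other.\<close>

fun pair_mult ::
  "('v list \<times> 'v list) option \<Rightarrow> ('v list \<times> 'v list) option \<Rightarrow> ('v list \<times> 'v list) option" where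
  "pair_mult (Some (p, q)) (Some (p', q')) =
     (if prefix q p' then Some (p @ drop (length q) p', q')
      else if prefix p' q then Some (p, q' @ drop (length p') q)
      else None)"
| "pair_mult _ _ = None"

definition pair_inv :: "('v list \<times> 'v list) option \<Rightarrow> ('v list \<times> 'v list) option" where
  "pair_inv = map_option (\<lambda>(p, q). (q, p))"

lemma pair_mult_closed:
  "x \<in> path_pairs E r \<Longrightarrow> y \<in> path_pairs E r \<Longrightarrow> pair_mult x y \<in> path_pairs E r"
  by (cases "(x, y)" rule: pair_mult.cases) (auto simp: path_pairs_def prefix_def)

lemma pair_inv_closed: "x \<in> path_pairs E r \<Longrightarrow> pair_inv x \<in> path_pairs E r"
  by (auto simp: path_pairs_def pair_inv_def)

text \<open>Unlike in \<open>left_translation\<close>, the domain is a parameter. With the empty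
  word this also covers restrictions of the identity.\<close>

definition prepend_on :: "'a list set \<Rightarrow> 'a list \<Rightarrow> ('a list \<rightharpoonup> 'a list)" where
  "prepend_on A s = (\<lambda>x. if x \<in> A then Some (s @ x) else None)"

lemma prepend_on_eq_Some: "prepend_on A s x = Some y \<longleftrightarrow> x \<in> A \<and> y = s @ x"
  by (auto simp: prepend_on_def)

lemma inj_prepend_on: "inj_on (prepend_on A s) (dom (prepend_on A s))"
  by (auto simp: inj_on_def dom_def prepend_on_def split: if_splits)

lemma pinv_prepend_on_eq_Some: "pinv (prepend_on A s) y = Some x \<longleftrightarrow> x \<in> A \<and> y = s @ x"
  by (simp add: pinv_eq_Some_iff[OF inj_prepend_on] prepend_on_eq_Some)

lemma map_eqI_Some: "(\<And>x y. f x = Some y \<longleftrightarrow> g x = Some y) \<Longrightarrow> f = g"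
  by (metis ext not_None_eq)

lemma prepend_on_comp_pinv_eq_Some:
  "(prepend_on A s \<circ>\<^sub>m pinv (prepend_on A t)) y = Some z \<longleftrightarrow> (\<exists>x\<in>A. y = t @ x \<and> z = s @ x)"
  by (auto simp: map_comp_Some_iff prepend_on_eq_Some pinv_prepend_on_eq_Some)

lemma dom_prepend_on_comp_pinv:
  "dom (prepend_on A s \<circ>\<^sub>m pinv (prepend_on A t)) = (\<lambda>x. t @ x) ` A"
  by (auto simp: dom_def prepend_on_comp_pinv_eq_Some)

lemma ran_prepend_on_comp_pinv:
  "ran (prepend_on A s \<circ>\<^sub>m pinv (prepend_on A t)) = (\<lambda>x. s @ x) ` A"
  by (auto simp: ran_def prepend_on_comp_pinv_eq_Some)

lemma pinv_prepend_on_comp_pinv: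
  "pinv (prepend_on A s \<circ>\<^sub>m pinv (prepend_on A t)) = prepend_on A t \<circ>\<^sub>m pinv (prepend_on A s)"
proof (rule map_eqI_Some)
  have "inj_on (prepend_on A s \<circ>\<^sub>m pinv (prepend_on A t))
      (dom (prepend_on A s \<circ>\<^sub>m pinv (prepend_on A t)))"
    by (rule inj_onI, unfold dom_def mem_Collect_eq not_None_eq)
      (smt (verit) prepend_on_comp_pinv_eq_Some same_append_eq)
  note eq = pinv_eq_Some_iff[OF this]
  show "pinv (prepend_on A s \<circ>\<^sub>m pinv (prepend_on A t)) x = Some y \<longleftrightarrow>
      (prepend_on A t \<circ>\<^sub>m pinv (prepend_on A s)) x = Some y" for x y
    by (auto simp: eq prepend_on_comp_pinv_eq_Some)
qed

text \<open>The edge \<open>u \<rightarrow> v\<close> acts as the injection of \<open>X v\<close> into \<open>X u\<close> that prepends \<open>lab u v\<close>.\<close>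

locale path_representation =
  fixes E :: "'v \<Rightarrow> 'v \<Rightarrow> bool" and lab :: "'v \<Rightarrow> 'v \<Rightarrow> 'a list" and X :: "'v \<Rightarrow> 'a list set"
  assumes X_nonempty: "X u \<noteq> {}"
    and edge_into: "E u v \<Longrightarrow> x \<in> X v \<Longrightarrow> lab u v @ x \<in> X u"
    and edge_disjoint: "E u v \<Longrightarrow> E u v' \<Longrightarrow> x \<in> X v \<Longrightarrow> x' \<in> X v' \<Longrightarrow>
      lab u v @ x = lab u v' @ x' \<Longrightarrow> v = v'"
    and edge_strict: "E u v \<Longrightarrow> \<exists>y\<in>X u. \<forall>x\<in>X v. y \<noteq> lab u v @ x"
begin

abbreviation path_map :: "'v \<Rightarrow> 'v list \<Rightarrow> ('a list \<rightharpoonup> 'a list)" where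
  "path_map u p \<equiv> prepend_on (X (path_end u p)) (path_word lab u p)"

fun pair_map :: "'v \<Rightarrow> ('v list \<times> 'v list) option \<Rightarrow> ('a list \<rightharpoonup> 'a list)" where
  "pair_map r (Some (p, q)) = path_map r p \<circ>\<^sub>m pinv (path_map r q)"
| "pair_map r None = Map.empty"

lemma path_into: "is_path E u p \<Longrightarrow> x \<in> X (path_end u p) \<Longrightarrow> path_word lab u p @ x \<in> X u"
  by (induction p arbitrary: u) (auto intro: edge_into)

text \<open>Where two paths first part, a common value would lie in the images of two different
  edges, against \<open>edge_disjoint\<close>. Incomparable paths therefore have disjoint images,
  which yields the zero products.\<close>

lemma paths_comparable:
  assumes "is_path E u p" "is_path E u q" "x \<in> X (path_end u p)" "y \<in> X (path_end u q)"
    and "path_word lab u p @ x = path_word lab u q @ y"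
  shows "prefix p q \<or> prefix q p"
  using assms
proof (induction p arbitrary: u q)
  case (Cons v p)
  show ?case
  proof (cases q)
    case q: (Cons v' q')
    let ?x = "path_word lab v p @ x" and ?y = "path_word lab v' q' @ y"
    have "?x \<in> X v" "?y \<in> X v'" "lab u v @ ?x = lab u v' @ ?y"
      using Cons.prems q by (auto intro: path_into)
    then have "v = v'" using edge_disjoint Cons.prems q by auto
    with Cons q show ?thesis by auto
  qed simp
qed simp

text \<open>By \<open>edge_strict\<close> the first edge already misses a word of
  \<open>X u\<close>, and the rest of the path maps into the domain of that edge.\<close>

lemma path_strict:
  assumes "is_path E u p" "\<And>y. y \<in> X u \<Longrightarrow> \<exists>x\<in>X (path_end u p). y = path_word lab u p @ x"
  shows "p = []"
proof (cases p)
  case (Cons v q)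
  with assms(1) obtain y where "y \<in> X u" "\<forall>x\<in>X v. y \<noteq> lab u v @ x"
    using edge_strict[of u v] by auto
  with assms Cons show ?thesis using path_into[of v q] by fastforce
qed simp

text \<open>Equal images are nonempty, so they meet and the paths are comparable. The part by which
  one extends the other is then onto, hence empty by \<open>path_strict\<close>.\<close>

lemma path_eqI:
  assumes p: "is_path E u p" and q: "is_path E u q"
    and eq: "(\<lambda>x. path_word lab u p @ x) ` X (path_end u p) =
      (\<lambda>x. path_word lab u q @ x) ` X (path_end u q)"
  shows "p = q"
proof -
  have absorb: "p' = q'" if "is_path E u q'" "prefix p' q'"
    "(\<lambda>x. path_word lab u p' @ x) ` X (path_end u p') =
     (\<lambda>x. path_word lab u q' @ x) ` X (path_end u q')" for p' q'
  proof -
    obtain s where s: "q' = p' @ s" using \<open>prefix p' q'\<close> by (auto simp: prefix_def)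
    have "s = []"
    proof (rule path_strict)
      fix y assume "y \<in> X (path_end u p')"
      then have "path_word lab u p' @ y \<in> (\<lambda>x. path_word lab u q' @ x) ` X (path_end u q')"
        using that(3) by blast
      then show "\<exists>x\<in>X (path_end (path_end u p') s). y = path_word lab (path_end u p') s @ x"
        by (auto simp: s)
    qed (use that s in auto)
    then show ?thesis using s by simp
  qed
  obtain x where x: "x \<in> X (path_end u p)" using X_nonempty by blast
  then have "path_word lab u p @ x \<in> (\<lambda>x. path_word lab u q @ x) ` X (path_end u q)"
    using eq by blast
  then obtain y where "y \<in> X (path_end u q)" "path_word lab u p @ x = path_word lab u q @ y"
    by blast
  then have "prefix p q \<or> prefix q p" using paths_comparable p q x by blast
  then show ?thesis using absorb p q eq by metis
qed

text \<open>The domain of the map of \<open>(p, q)\<close> is the image of q and its range is the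
  image of p; \<open>path_eqI\<close> recovers both paths. Nonempty \<open>X\<close> separates these
  maps from zero.\<close>

lemma inj_on_pair_map: "inj_on (pair_map r) (path_pairs E r)"
proof (rule inj_onI)
  have nonzero: "pair_map r x \<noteq> Map.empty" if x: "x \<noteq> None" "x \<in> path_pairs E r" for x
  proof -
    obtain p q where "x = Some (p, q)" "path_end r p = path_end r q"
      using x unfolding path_pairs_def by blast
    then have "dom (pair_map r x) \<noteq> {}"
      by (simp add: dom_prepend_on_comp_pinv X_nonempty)
    then show ?thesis by auto
  qed
  fix x y assume xy: "x \<in> path_pairs E r" "y \<in> path_pairs E r" "pair_map r x = pair_map r y"
  show "x = y"
  proof (cases "x = None \<or> y = None")
    case True
    then show ?thesis using nonzero xy by (metis not_None_eq pair_map.simps(2))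
  next
    case False
    then obtain p q p' q' where *: "x = Some (p, q)" "y = Some (p', q')"
      "is_path E r p" "is_path E r q" "is_path E r p'" "is_path E r q'"
      "path_end r p = path_end r q" "path_end r p' = path_end r q'"
      using xy by (auto simp: path_pairs_def)
    have "dom (pair_map r x) = dom (pair_map r y)" "ran (pair_map r x) = ran (pair_map r y)"
      using xy by simp_all
    then have images: "(\<lambda>x. path_word lab r p @ x) ` X (path_end r p) =
        (\<lambda>x. path_word lab r p' @ x) ` X (path_end r p')"
      "(\<lambda>x. path_word lab r q @ x) ` X (path_end r q) =
        (\<lambda>x. path_word lab r q' @ x) ` X (path_end r q')"
      by (simp_all add: * dom_prepend_on_comp_pinv ran_prepend_on_comp_pinv)
    have "p = p'" by (rule path_eqI[OF *(3,5) images(1)])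
    moreover have "q = q'" by (rule path_eqI[OF *(4,6) images(2)])
    ultimately show ?thesis using * by simp
  qed
qed

lemma pair_map_inv: "x \<in> path_pairs E r \<Longrightarrow> pair_map r (pair_inv x) = pinv (pair_map r x)"
  by (auto simp: path_pairs_def pair_inv_def pinv_prepend_on_comp_pinv)
    (simp add: pinv_def fun_eq_iff)

lemma pair_map_mult:
  assumes "x \<in> path_pairs E r" "y \<in> path_pairs E r"
  shows "pair_map r (pair_mult x y) = pair_map r x \<circ>\<^sub>m pair_map r y"
proof (cases "x = None \<or> y = None")
  case True
  then show ?thesis by (cases x; cases y) (auto simp: map_comp_def fun_eq_iff split: option.splits)
next
  case False
  then obtain p q p' q' where *: "x = Some (p, q)" "y = Some (p', q')"
    "is_path E r p" "is_path E r q" "is_path E r p'" "is_path E r q'"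
    "path_end r p = path_end r q" "path_end r p' = path_end r q'"
    using assms by (auto simp: path_pairs_def)
  have pair: "pair_map r x b = Some c \<longleftrightarrow>
      (\<exists>v\<in>X (path_end r q). b = path_word lab r q @ v \<and> c = path_word lab r p @ v)"
    "pair_map r y a = Some b \<longleftrightarrow>
      (\<exists>u\<in>X (path_end r q'). a = path_word lab r q' @ u \<and> b = path_word lab r p' @ u)" for a b c
    by (simp_all add: * prepend_on_comp_pinv_eq_Some)
  have comp: "(pair_map r x \<circ>\<^sub>m pair_map r y) a = Some b \<longleftrightarrow>
    (\<exists>u\<in>X (path_end r q'). \<exists>v\<in>X (path_end r q). a = path_word lab r q' @ u \<and>
      path_word lab r p' @ u = path_word lab r q @ v \<and> b = path_word lab r p @ v)" for a b
    by (auto simp: map_comp_Some_iff[of "pair_map r x"] pair)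
  \<comment> \<open>These are the branches of \<open>pair_mult\<close>; the second excludes
    \<open>prefix q p'\<close> because the first branch takes precedence when q = p'.\<close>
  consider (1) s where "p' = q @ s" | (2) s where "q = p' @ s" "\<not> prefix q p'"
    | (3) "\<not> prefix q p'" "\<not> prefix p' q" unfolding prefix_def by blast
  then show ?thesis
  proof cases
    case 1
    then have mult: "pair_mult x y = Some (p @ s, q')" by (simp add: *)
    have "path_word lab (path_end r q) s @ u \<in> X (path_end r q)"
      if "u \<in> X (path_end r q')" for u
      using that * 1 by (auto intro: path_into)
    then show ?thesis
      using *(3-) 1 unfolding mult
      by (intro map_eqI_Some, unfold comp) (auto simp: prepend_on_comp_pinv_eq_Some)
  next
    case 2
    then have mult: "pair_mult x y = Some (p, q' @ s)" by (simp add: *)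
    have "path_word lab (path_end r q') s @ u \<in> X (path_end r q')"
      if "u \<in> X (path_end r q)" for u
      using that * 2 by (auto intro: path_into)
    then show ?thesis
      using *(3-) 2 unfolding mult
      by (intro map_eqI_Some, unfold comp) (auto simp: prepend_on_comp_pinv_eq_Some)
  next
    case 3
    then have "pair_mult x y = None" by (simp add: *)
    moreover have "(pair_map r x \<circ>\<^sub>m pair_map r y) a \<noteq> Some b" for a b
      unfolding comp using 3 paths_comparable[of r p' q] * by metis
    ultimately show ?thesis by (intro map_eqI_Some) simp
  qed
qed

section \<open>The inverse hull as the image of the path pairs\<close>

lemma path_map_in_hull:
  assumes "\<And>u. prepend_on (X u) [] \<in> inverse_hull L"
    and "\<And>u v. E u v \<Longrightarrow> prepend_on (X v) (lab u v) \<in> inverse_hull L"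
    and "is_path E u p"
  shows "path_map u p \<in> inverse_hull L"
  using assms(3)
proof (induction p arbitrary: u)
  case (Cons v p)
  then have "prepend_on (X v) (lab u v) \<circ>\<^sub>m path_map v p \<in> inverse_hull L"
    by (auto intro!: inverse_hull.comp assms)
  \<comment> \<open>By \<open>path_into\<close> the rest of the path lands in \<open>X v\<close>, so
    composing with the first edge does not shrink the domain.\<close>
  moreover have "prepend_on (X v) (lab u v) \<circ>\<^sub>m path_map v p = path_map u (v # p)"
    using Cons.prems path_into[of v p]
    by (intro map_eqI_Some) (auto simp: map_comp_Some_iff prepend_on_eq_Some)
  ultimately show ?case by simp
qed (simp add: assms)

text \<open>In one direction, the image is closed under the operations and contains every
  translation, a product of letter translations. In the other, each edge map is a letter translation
  or a restriction of the identity, and both lie in the hull.\<close>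

lemma hull_eq_pair_map_image:
  fixes fol :: "'a \<Rightarrow> 'v"
  assumes append_right: "\<And>u v. u @ v \<in> L \<Longrightarrow> v \<noteq> [] \<Longrightarrow> v \<in> L" and "[] \<notin> L"
    and X_fol: "\<And>a. X (fol a) = {x \<in> L. a # x \<in> L}" and "surj fol"
    and lab: "\<And>u v. E u v \<Longrightarrow> lab u v = [] \<or> (\<exists>a. fol a = v \<and> lab u v = [a])"
    and letter: "\<And>a. \<exists>p q. is_path E r p \<and> is_path E r q \<and> path_end r p = fol a \<and>
      path_end r q = fol a \<and> path_word lab r p = [a] \<and> path_word lab r q = []"
    and letter_in: "\<And>a. [a] \<in> L"
  shows "inverse_hull L = pair_map r ` path_pairs E r"
proof (intro equalityI subsetI)
  have lt: "left_translation L [a] = prepend_on (X (fol a)) [a]" for a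
    by (auto simp: left_translation_def prepend_on_def X_fol fun_eq_iff)
  have letter_pair: "left_translation L [a] \<in> pair_map r ` path_pairs E r" for a
  proof -
    obtain p q where pq: "is_path E r p" "is_path E r q" "path_end r p = fol a"
      "path_end r q = fol a" "path_word lab r p = [a]" "path_word lab r q = []"
      using letter by blast
    then have "pair_map r (Some (p, q)) = left_translation L [a]"
      by (intro map_eqI_Some) (auto simp: lt prepend_on_comp_pinv_eq_Some prepend_on_eq_Some)
    moreover have "Some (p, q) \<in> path_pairs E r" using pq by (auto simp: path_pairs_def)
    ultimately show ?thesis by (metis imageI)
  qed
  have translation: "left_translation L s \<in> pair_map r ` path_pairs E r" if "s \<in> L" for s
    using that
  proof (induction s)
    case (Cons a w)
    show ?case
    proof (cases "w = []")
      case False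
      then have "w \<in> L" using Cons.prems append_right[of "[a]" w] by simp
      \<comment> \<open>Closure of \<open>L\<close> under nonempty suffixes puts
        \<open>w @ x\<close> in \<open>L\<close>, so both sides have the same domain.\<close>
      have "left_translation L (a # w) = left_translation L [a] \<circ>\<^sub>m left_translation L w"
      proof (rule ext)
        fix x
        show "left_translation L (a # w) x = (left_translation L [a] \<circ>\<^sub>m left_translation L w) x"
          using append_right[of "[a]" "w @ x"] False by (auto simp: left_translation_def map_comp_def)
      qed
      with Cons.IH[OF \<open>w \<in> L\<close>] letter_pair[of a] show ?thesis
        by (auto simp flip: pair_map_mult intro: pair_mult_closed)
    qed (simp add: letter_pair)
  qed (simp add: \<open>[] \<notin> L\<close>)
  fix f
  {
    assume "f \<in> inverse_hull L"
    then show "f \<in> pair_map r ` path_pairs E r"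
    proof induction
      case zero
      show ?case by (rule image_eqI[of _ _ None]) (auto simp: path_pairs_def)
    next
      case (comp f g)
      then show ?case by (auto simp flip: pair_map_mult intro: pair_mult_closed)
    next
      case (inverse f)
      then show ?case by (auto simp flip: pair_map_inv intro: pair_inv_closed)
    qed (rule translation)
  }
  have letter_hull: "prepend_on (X (fol a)) [a] \<in> inverse_hull L" for a
    using inverse_hull.generator[OF letter_in[of a]] by (simp add: lt)
  have id_hull: "prepend_on (X u) [] \<in> inverse_hull L" for u
  proof -
    obtain a where a: "u = fol a" using \<open>surj fol\<close> by blast
    \<comment> \<open>Every vertex is \<open>fol a\<close> for some letter a, and the domain
      projection of that letter's translation is the identity on \<open>X u\<close>.\<close>
    have "prepend_on (X u) [] = pinv (prepend_on (X u) [a]) \<circ>\<^sub>m prepend_on (X u) [a]"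
      by (intro map_eqI_Some)
        (auto simp: map_comp_Some_iff prepend_on_eq_Some pinv_prepend_on_eq_Some)
    then show ?thesis
      using letter_hull[of a] by (simp add: a inverse_hull.comp inverse_hull.inverse)
  qed
  have edge_hull: "prepend_on (X v) (lab u v) \<in> inverse_hull L" if "E u v" for u v
    using lab[OF that] id_hull[of v] letter_hull by auto
  assume "f \<in> pair_map r ` path_pairs E r"
  then show "f \<in> inverse_hull L"
    using path_map_in_hull[OF id_hull edge_hull, of r]
    by (auto simp: path_pairs_def intro!: inverse_hull.comp inverse_hull.inverse
      inverse_hull.zero) metis
qed

end

text \<open>Both images are faithful copies of the same path pairs; the isomorphism goes back along
  one representation and forward along the other.\<close>

lemma path_representations_isomorphic:
  assumes "path_representation E lab X" "path_representation E lab' X'"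
  shows "inverse_semigroup_isomorphic
    (path_representation.pair_map lab X r ` path_pairs E r)
    (path_representation.pair_map lab' X' r ` path_pairs E r)"
proof -
  interpret A: path_representation E lab X by fact
  interpret B: path_representation E lab' X' by fact
  define \<phi> where "\<phi> = B.pair_map r \<circ> inv_into (path_pairs E r) (A.pair_map r)"
  have \<phi>: "\<phi> (A.pair_map r x) = B.pair_map r x" if "x \<in> path_pairs E r" for x
    using that A.inj_on_pair_map by (simp add: \<phi>_def)
  have "bij_betw \<phi> (A.pair_map r ` path_pairs E r) (B.pair_map r ` path_pairs E r)"
    unfolding \<phi>_def
    by (rule bij_betw_trans[OF bij_betw_inv_into])
      (auto simp: bij_betw_def A.inj_on_pair_map B.inj_on_pair_map)
  moreover have "\<phi> (A.pair_map r x \<circ>\<^sub>m A.pair_map r y) = \<phi> (A.pair_map r x) \<circ>\<^sub>m \<phi> (A.pair_map r y)"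
    if "x \<in> path_pairs E r" "y \<in> path_pairs E r" for x y
    using that by (simp add: \<phi> pair_mult_closed flip: A.pair_map_mult B.pair_map_mult)
  moreover have "\<phi> (pinv (A.pair_map r x)) = pinv (\<phi> (A.pair_map r x))"
    if "x \<in> path_pairs E r" for x
    using that by (simp add: \<phi> pair_inv_closed flip: A.pair_map_inv B.pair_map_inv)
  ultimately show ?thesis unfolding inverse_semigroup_isomorphic_def by blast
qed

section \<open>The two hulls\<close>

lemma Cons_in_language:
  assumes "markov_matrix T"
  shows "a # x \<in> language (markov_shift T) \<longleftrightarrow>
    x = [] \<or> T a (hd x) = 1 \<and> x \<in> language (markov_shift T)"
  using assms by (auto simp: language_markov_shift successively_Cons)

lemma Nil_notin_language: "[] \<notin> language S"
  by (simp add: language_def)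

section \<open>The common graph and its two labellings\<close>

datatype vertex = VP | VQ | VR

definition edge :: "vertex \<Rightarrow> vertex \<Rightarrow> bool" where
  "edge u v \<longleftrightarrow> (u, v) \<in> {(VP, VQ), (VP, VR), (VQ, VP), (VQ, VR), (VR, VQ)}"

primrec letters1 :: "vertex \<Rightarrow> abc set" where
  "letters1 VP = UNIV"
| "letters1 VQ = {La, Lc}"
| "letters1 VR = {Lb}"

primrec letters2 :: "vertex \<Rightarrow> xyz set" where
  "letters2 VP = UNIV"
| "letters2 VQ = {Lx, Ly}"
| "letters2 VR = {Ly}"

primrec follower1 :: "abc \<Rightarrow> vertex" where
  "follower1 La = VP" | "follower1 Lb = VQ" | "follower1 Lc = VR"

primrec follower2 :: "xyz \<Rightarrow> vertex" where
  "follower2 Lx = VP" | "follower2 Ly = VQ" | "follower2 Lz = VR"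

text \<open>The edges with empty label shrink the set of admissible next letters: from the full alphabet
  to \<open>{a, c}\<close> or \<open>{b}\<close> for \<open>T1\<close>, and along the chain \<open>{x, y, z} \<supset> {x, y} \<supset> {y}\<close> for \<open>T2\<close>.\<close>

fun label1 :: "vertex \<Rightarrow> vertex \<Rightarrow> abc list" where
  "label1 VQ VP = [La]" | "label1 VQ VR = [Lc]" | "label1 VR VQ = [Lb]" | "label1 _ _ = []"

fun label2 :: "vertex \<Rightarrow> vertex \<Rightarrow> xyz list" where
  "label2 VP VR = [Lz]" | "label2 VQ VP = [Lx]" | "label2 VR VQ = [Ly]" | "label2 _ _ = []"

lemma T1_eq_1: "T1 s t = 1 \<longleftrightarrow> t \<in> letters1 (follower1 s)"
  by (cases s; cases t) auto

lemma T2_eq_1: "T2 s t = 1 \<longleftrightarrow> t \<in> letters2 (follower2 s)"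
  by (cases s; cases t) auto

definition words1 :: "vertex \<Rightarrow> abc list set" where
  "words1 v = {w \<in> language (markov_shift T1). hd w \<in> letters1 v}"

definition words2 :: "vertex \<Rightarrow> xyz list set" where
  "words2 v = {w \<in> language (markov_shift T2). hd w \<in> letters2 v}"

lemma Cons_in_words1:
  "a # x \<in> words1 v \<longleftrightarrow> a \<in> letters1 v \<and> (x = [] \<or> x \<in> words1 (follower1 a))"
  by (auto simp: words1_def Cons_in_language markov_matrix_T1 T1_eq_1[unfolded One_nat_def] Nil_notin_language)

lemma Cons_in_words2:
  "a # x \<in> words2 v \<longleftrightarrow> a \<in> letters2 v \<and> (x = [] \<or> x \<in> words2 (follower2 a))"
  by (auto simp: words2_def Cons_in_language markov_matrix_T2 T2_eq_1[unfolded One_nat_def] Nil_notin_language)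

interpretation R1: path_representation edge label1 words1
proof
  show "words1 u \<noteq> {}" for u
  proof -
    obtain a where "a \<in> letters1 u" by (cases u) auto
    then have "[a] \<in> words1 u" by (simp add: Cons_in_words1)
    then show ?thesis by blast
  qed
  show "label1 u v @ x \<in> words1 u" if "edge u v" "x \<in> words1 v" for u v x
    using that by (auto simp: edge_def Cons_in_words1) (auto simp: words1_def)
  show "v = v'" if "edge u v" "edge u v'" "x \<in> words1 v" "x' \<in> words1 v'"
    "label1 u v @ x = label1 u v' @ x'" for u v v' x x'
    using that by (auto simp: edge_def words1_def)
  show "\<exists>y\<in>words1 u. \<forall>x\<in>words1 v. y \<noteq> label1 u v @ x" if "edge u v" for u v
  proof -
    have "[] \<notin> words1 v" by (simp add: words1_def Nil_notin_language)
    \<comment> \<open>A one-letter word of \<open>u\<close> outside the image of the edge. For the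
      edge from \<open>VR\<close> to \<open>VQ\<close> the letter is the label itself, and the word
      is missed because the empty word is excluded.\<close>
    define a where "a = (case (u, v) of (VP, VQ) \<Rightarrow> Lb | (VQ, VP) \<Rightarrow> Lc | (VR, _) \<Rightarrow> Lb | _ \<Rightarrow> La)"
    have "[a] \<in> words1 u" "\<forall>x\<in>words1 v. [a] \<noteq> label1 u v @ x"
      using that \<open>[] \<notin> words1 v\<close> by (auto simp: a_def edge_def Cons_in_words1)
    then show ?thesis by blast
  qed
qed

interpretation R2: path_representation edge label2 words2
proof
  show "words2 u \<noteq> {}" for u
  proof -
    obtain a where "a \<in> letters2 u" by (cases u) auto
    then have "[a] \<in> words2 u" by (simp add: Cons_in_words2)
    then show ?thesis by blast
  qed
  show "label2 u v @ x \<in> words2 u" if "edge u v" "x \<in> words2 v" for u v x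
    using that by (auto simp: edge_def Cons_in_words2) (auto simp: words2_def)
  show "v = v'" if "edge u v" "edge u v'" "x \<in> words2 v" "x' \<in> words2 v'"
    "label2 u v @ x = label2 u v' @ x'" for u v v' x x'
    using that by (auto simp: edge_def words2_def)
  show "\<exists>y\<in>words2 u. \<forall>x\<in>words2 v. y \<noteq> label2 u v @ x" if "edge u v" for u v
  proof -
    have "[] \<notin> words2 v" by (simp add: words2_def Nil_notin_language)
    define a where "a = (case (u, v) of (VP, VQ) \<Rightarrow> Lz | (VQ, VP) \<Rightarrow> Ly | (VR, _) \<Rightarrow> Ly | _ \<Rightarrow> Lx)"
    have "[a] \<in> words2 u" "\<forall>x\<in>words2 v. [a] \<noteq> label2 u v @ x"
      using that \<open>[] \<notin> words2 v\<close> by (auto simp: a_def edge_def Cons_in_words2)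
    then show ?thesis by blast
  qed
qed

text \<open>Paths start at \<open>VP\<close> because \<open>words1 VP\<close> is the whole language
  on which the hull acts.\<close>

lemma inverse_hull_T1:
  "inverse_hull (language (markov_shift T1)) = R1.pair_map VP ` path_pairs edge VP"
proof (rule R1.hull_eq_pair_map_image[where fol = follower1])
  show "words1 (follower1 a) =
    {x \<in> language (markov_shift T1). a # x \<in> language (markov_shift T1)}" for a
    by (auto simp: words1_def Cons_in_language markov_matrix_T1 T1_eq_1[unfolded One_nat_def] Nil_notin_language)
  have "v = follower1 (case v of VP \<Rightarrow> La | VQ \<Rightarrow> Lb | VR \<Rightarrow> Lc)" for v by (cases v) auto
  then show "surj follower1" by (rule surjI[OF sym])
  show "label1 u v = [] \<or> (\<exists>a. follower1 a = v \<and> label1 u v = [a])" if "edge u v" for u v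
    using that by (auto simp: edge_def)
  show "\<exists>p q. is_path edge VP p \<and> is_path edge VP q \<and> path_end VP p = follower1 a \<and>
      path_end VP q = follower1 a \<and> path_word label1 VP p = [a] \<and> path_word label1 VP q = []" for a
  \<comment> \<open>The path p narrows the admissible letters until the edge spelling
    \<open>a\<close> is available; q only narrows them to the follower set of
    \<open>a\<close>.\<close>
  proof (cases a)
    case La
    then show ?thesis by (intro exI[of _ "[VQ, VP]"] exI[of _ "[]"]) (simp add: edge_def)
  next
    case Lb
    then show ?thesis by (intro exI[of _ "[VR, VQ]"] exI[of _ "[VQ]"]) (simp add: edge_def)
  next
    case Lc
    then show ?thesis by (intro exI[of _ "[VQ, VR]"] exI[of _ "[VR]"]) (simp add: edge_def)
  qed
qed (auto simp: Nil_notin_language Cons_in_language markov_matrix_T1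
  intro: language_append_right[OF markov_matrix_T1])

lemma inverse_hull_T2:
  "inverse_hull (language (markov_shift T2)) = R2.pair_map VP ` path_pairs edge VP"
proof (rule R2.hull_eq_pair_map_image[where fol = follower2])
  show "words2 (follower2 a) =
    {x \<in> language (markov_shift T2). a # x \<in> language (markov_shift T2)}" for a
    by (auto simp: words2_def Cons_in_language markov_matrix_T2 T2_eq_1[unfolded One_nat_def] Nil_notin_language)
  have "v = follower2 (case v of VP \<Rightarrow> Lx | VQ \<Rightarrow> Ly | VR \<Rightarrow> Lz)" for v by (cases v) auto
  then show "surj follower2" by (rule surjI[OF sym])
  show "label2 u v = [] \<or> (\<exists>a. follower2 a = v \<and> label2 u v = [a])" if "edge u v" for u v
    using that by (auto simp: edge_def)
  show "\<exists>p q. is_path edge VP p \<and> is_path edge VP q \<and> path_end VP p = follower2 a \<and>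
      path_end VP q = follower2 a \<and> path_word label2 VP p = [a] \<and> path_word label2 VP q = []" for a
  \<comment> \<open>The pattern is the same, but now {y} is reached through {x, y}: before spelling
    y, the path p narrows twice.\<close>
  proof (cases a)
    case Lx
    then show ?thesis by (intro exI[of _ "[VQ, VP]"] exI[of _ "[]"]) (simp add: edge_def)
  next
    case Ly
    then show ?thesis by (intro exI[of _ "[VQ, VR, VQ]"] exI[of _ "[VQ]"]) (simp add: edge_def)
  next
    case Lz
    then show ?thesis by (intro exI[of _ "[VR]"] exI[of _ "[VQ, VR]"]) (simp add: edge_def)
  qed
qed (auto simp: Nil_notin_language Cons_in_language markov_matrix_T2
  intro: language_append_right[OF markov_matrix_T2])

section \<open>The two shifts\<close>

lemma UNIV_abc: "(UNIV :: abc set) = {La, Lb, Lc}"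
  using abc.exhaust by blast

lemma UNIV_xyz: "(UNIV :: xyz set) = {Lx, Ly, Lz}"
  using xyz.exhaust by blast

lemma has_entropy_T1: "has_entropy (markov_shift T1) (ln 2)"
\<comment> \<open>With entry 1 at c and eigenvalue 2, row c forces 2 at b and row b forces 4 - 1 = 3
  at a.\<close>
proof (rule has_entropy_eigenvector[where v = "case_abc 3 2 1"])
  show "(case_abc 3 2 1 s :: real) > 0" for s by (cases s) auto
  show "(\<Sum>t\<in>UNIV. real (T1 s t) * case_abc 3 2 1 t) = 2 * case_abc 3 2 1 s" for s
    by (cases s) (auto simp: UNIV_abc)
qed (auto simp: markov_matrix_T1 UNIV_abc)

text \<open>The characteristic polynomial of \<open>T2\<close> is \<open>\<mu>\<^sup>3 - 2 * \<mu>\<^sup>2 - 1\<close>, which is negative at \<open>2\<close>.\<close>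

lemma has_entropy_T2: "\<exists>\<mu>>2. has_entropy (markov_shift T2) (ln \<mu>)"
proof -
  have "\<exists>\<mu>\<ge>2. \<mu> \<le> 3 \<and> \<mu> ^ 3 - 2 * \<mu> ^ 2 - 1 = (0 :: real)"
    by (rule IVT') (auto intro!: continuous_intros)
  then obtain \<mu> :: real where \<mu>: "\<mu> \<ge> 2" "\<mu> ^ 3 = 2 * \<mu> ^ 2 + 1" by auto
  have "\<mu> \<noteq> 2" using \<mu>(2) by auto
  with \<mu>(1) have "\<mu> > 2" by simp
  \<comment> \<open>With entry 1 at z, row z forces \<open>\<mu>\<close> at y and row y forces
    \<open>\<mu> * (\<mu> - 1)\<close> at x; row x is then the cubic equation.\<close>
  let ?v = "case_xyz (\<mu> * (\<mu> - 1)) \<mu> 1"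
  have "has_entropy (markov_shift T2) (ln \<mu>)"
  proof (rule has_entropy_eigenvector[where v = ?v])
    show "?v s > 0" for s using \<open>\<mu> > 2\<close> by (cases s) auto
    show "(\<Sum>t\<in>UNIV. real (T2 s t) * ?v t) = \<mu> * ?v s" for s
      using \<mu>(2) by (cases s) (auto simp: UNIV_xyz algebra_simps power2_eq_square power3_eq_cube)
  qed (use \<open>\<mu> > 2\<close> in \<open>auto simp: markov_matrix_T2 UNIV_xyz\<close>)
  with \<open>\<mu> > 2\<close> show ?thesis by blast
qed

section \<open>Fixed points of the shift maps\<close>

lemma shift_map_fixed_iff: "shift_map x = x \<longleftrightarrow> (\<exists>a. x = (\<lambda>_. a))"
proof
  assume "shift_map x = x"
  then have "x (Suc i) = x i" for i by (metis shift_map_def)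
  then have "x i = x 0" for i by (induction i) auto
  then show "\<exists>a. x = (\<lambda>_. a)" by blast
qed (auto simp: shift_map_def)

lemma shift_map_in_markov_shift: "x \<in> markov_shift T \<Longrightarrow> shift_map x \<in> markov_shift T"
  by (simp add: markov_shift_def shift_map_def)

text \<open>A conjugacy matches fixed points of the shift maps: \<open>a\<^sup>\<infinity>\<close> is the only one for \<open>T1\<close>, while
  \<open>T2\<close> has \<open>x\<^sup>\<infinity>\<close> and \<open>y\<^sup>\<infinity>\<close>.\<close>

lemma not_conjugate_T1_T2: "\<not> conjugate_shifts (markov_shift T1) (markov_shift T2)"
proof
  assume "conjugate_shifts (markov_shift T1) (markov_shift T2)"
  then obtain h where
    "homeomorphic_map (shift_topology (markov_shift T1)) (shift_topology (markov_shift T2)) h"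
    and comm: "\<And>x. x \<in> markov_shift T1 \<Longrightarrow> h (shift_map x) = shift_map (h x)"
    unfolding conjugate_shifts_def by blast
  then have inj: "inj_on h (markov_shift T1)" and onto: "h ` markov_shift T1 = markov_shift T2"
    by (simp_all add: homeomorphic_eq_everything_map)
  have fixed: "h (\<lambda>_. La) = (\<lambda>_. a)" if "T2 a a = 1" for a
  proof -
    have "(\<lambda>_. a) \<in> markov_shift T2" using that by (simp add: markov_shift_def)
    then obtain x where x: "x \<in> markov_shift T1" "h x = (\<lambda>_. a)" using onto by (metis imageE)
    \<comment> \<open>The preimage of a fixed point is fixed, since \<open>h\<close> commutes with
      the shift and is injective.\<close>
    then have "h (shift_map x) = h x" using comm by (simp add: shift_map_def)
    then have "shift_map x = x" using inj x shift_map_in_markov_shift by (metis inj_onD)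
    then obtain b where b: "x = (\<lambda>_. b)" unfolding shift_map_fixed_iff by blast
    then have "T1 b b = 1" using x by (simp add: markov_shift_def)
    then have "b = La" by (cases b) auto
    with x b show ?thesis by simp
  qed
  have "(\<lambda>_ :: nat. Lx) = (\<lambda>_. Ly)" using fixed[of Lx] fixed[of Ly] by simp
  then show False by (metis xyz.distinct(1))
qed

theorem mainTheorem2:
  "inverse_semigroup_isomorphic
     (inverse_hull (language (markov_shift T1)))
     (inverse_hull (language (markov_shift T2))) \<and>
   (\<exists>h1 h2. has_entropy (markov_shift T1) h1 \<and> has_entropy (markov_shift T2) h2 \<and> h1 \<noteq> h2) \<and>
   \<not> conjugate_shifts (markov_shift T1) (markov_shift T2)"
proof (intro conjI)
  show "inverse_semigroup_isomorphic
     (inverse_hull (language (markov_shift T1)))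
     (inverse_hull (language (markov_shift T2)))"
    unfolding inverse_hull_T1 inverse_hull_T2
    by (rule path_representations_isomorphic)
      (fact R1.path_representation_axioms R2.path_representation_axioms)+
  obtain \<mu> where \<mu>: "\<mu> > 2" "has_entropy (markov_shift T2) (ln \<mu>)" using has_entropy_T2 by blast
  then have "ln 2 < ln \<mu>" by simp
  with \<mu> has_entropy_T1 show "\<exists>h1 h2. has_entropy (markov_shift T1) h1 \<and>
    has_entropy (markov_shift T2) h2 \<and> h1 \<noteq> h2" by force
qed (rule not_conjugate_T1_T2)

end
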